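(* Let $(\mathcal{F}_n)_{n\ge0}$ be a filtration. Let $(B_n)_{n\ge1}$ be a sequence of nonnegative random variables that is predictable with respect to $(\mathcal{F}_n)_{n\ge0}$. Let $(R_n^\circ)_{n\ge1}$ (returns per unit bet, $R_n^\circ\ge0$) and $(X_n^\circ)_{n\ge1}$ (profits per unit bet, $X_n^\circ=R_n^\circ-1$) each be i.i.d. and adapted to $(\mathcal{F}_n)_{n\ge0}$, with $R_n^\circ$ independent of $\mathcal{F}_{n-1}$ and $X_n^\circ$ independent of $\mathcal{F}_{n-1}$ for each $n\ge1$. Put $R_n=B_nR_n^\circ$, $X_n=B_nX_n^\circ$, and $$\mathfrak{R}_n:=\frac{\sum_{k=1}^n R_k}{\sum_{k=1}^n B_k},\qquad \mathfrak{X}_n:=\frac{\sum_{k=1}^n X_k}{\sum_{k=1}^n B_k}.$$ Suppose that $$\sup_{n\ge1}\mathbb{E}[B_n^2]<\infty\qquad\text{and}\qquad\liminf_{n\to\infty}\frac1n\sum_{k=1}^n B_k>0\quad\text{a.s.}$$ If $\mathbb{E}[(R_1^\circ)^2]<\infty$, or equivalently $\mathbb{E}[(X_1^\circ)^2]<\infty$, then $$\lim_{n\to\infty}\mathfrak{R}_n=\mathrm{RTP}(1,R_1^\circ)\quad\text{a.s.}\qquad\text{and}\qquad\lim_{n\to\infty}\mathfrak{X}_n=-\mathrm{HA}(1,X_1^\circ)\quad\text{a.s.}$$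
   Context: All random variables live on a common probability space. $\mathcal{F}_n$ is interpreted as the $\sigma$-algebra of all events known following the $n$th coup. Predictable means $B_n$ is $\mathcal{F}_{n-1}$-measurable for every $n\ge1$. For a bet $B\ge0$, return $R\ge0$, and profit $X=R-B$, with $0<\mathbb{E}[B]<\infty$, $\mathbb{E}[R]<\infty$, $\mathbb{E}[|X|]<\infty$, the return to player and house advantage are $$\mathrm{RTP}(B,R):=\frac{\mathbb{E}[R]}{\mathbb{E}[B]},\qquad \mathrm{HA}(B,X):=-\frac{\mathbb{E}[X]}{\mathbb{E}[B]};$$ so $\mathrm{RTP}(1,R_1^\circ)=\mathbb{E}[R_1^\circ]$ and $\mathrm{HA}(1,X_1^\circ)=-\mathbb{E}[X_1^\circ]$. The ratios $\mathfrak{R}_n,\mathfrak{X}_n$ are considered for $n$ large enough that the denominator is positive (which holds eventually, almost surely). *)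

theory Defs
  imports "HOL-Probability.Probability" "HOL-Probability.Stopping_Time"
begin

text \<open>
  All sequences of random variables are indexed by \<open>n \<ge> 1\<close>, as functions on \<open>nat\<close> whose
  value at \<open>0\<close> is irrelevant; filtrations are indexed by \<open>n \<ge> 0\<close>.
\<close>

definition filtration_on :: "'a measure \<Rightarrow> (nat \<Rightarrow> 'a measure) \<Rightarrow> bool" where
  "filtration_on M F \<longleftrightarrow> filtration (space M) F \<and> (\<forall>n. subalgebra M (F n))"

definition adapted_seq :: "(nat \<Rightarrow> 'a measure) \<Rightarrow> (nat \<Rightarrow> 'a \<Rightarrow> real) \<Rightarrow> bool" where
  "adapted_seq F Y \<longleftrightarrow> (\<forall>n\<ge>1. Y n \<in> borel_measurable (F n))"

definition predictable_seq :: "(nat \<Rightarrow> 'a measure) \<Rightarrow> (nat \<Rightarrow> 'a \<Rightarrow> real) \<Rightarrow> bool" where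
  "predictable_seq F Y \<longleftrightarrow> (\<forall>n\<ge>1. Y n \<in> borel_measurable (F (n - 1)))"

definition iid_seq :: "'a measure \<Rightarrow> (nat \<Rightarrow> 'a \<Rightarrow> real) \<Rightarrow> bool" where
  "iid_seq M Y \<longleftrightarrow>
     prob_space.indep_vars M (\<lambda>_. borel) Y {1..} \<and>
     (\<forall>n\<ge>1. distr M borel (Y n) = distr M borel (Y 1))"

definition indep_of_algebra :: "'a measure \<Rightarrow> ('a \<Rightarrow> real) \<Rightarrow> 'a measure \<Rightarrow> bool" where
  "indep_of_algebra M Y G \<longleftrightarrow>
     Y \<in> borel_measurable M \<and>
     prob_space.indep_set M (sets (vimage_algebra (space M) Y borel)) (sets G)"

text \<open>
  The next two definitions are meant for integrable arguments with \<open>E[B] > 0\<close>; the Bochner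
  integral is \<open>0\<close> on non-integrable functions.
\<close>

definition RTP :: "'a measure \<Rightarrow> ('a \<Rightarrow> real) \<Rightarrow> ('a \<Rightarrow> real) \<Rightarrow> real" where
  "RTP M B R = (\<integral>\<omega>. R \<omega> \<partial>M) / (\<integral>\<omega>. B \<omega> \<partial>M)"

definition HA :: "'a measure \<Rightarrow> ('a \<Rightarrow> real) \<Rightarrow> ('a \<Rightarrow> real) \<Rightarrow> real" where
  "HA M B X = - ((\<integral>\<omega>. X \<omega> \<partial>M) / (\<integral>\<omega>. B \<omega> \<partial>M))"

text \<open>
  The cumulative amount \<open>Y\<close> (returned or won) per unit bet. It equals \<open>0\<close> for those \<open>n\<close> at
  which nothing has been bet yet, which does not affect limits along paths with an
  eventually positive total bet.
\<close>

definition cumulative_ratio ::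
    "(nat \<Rightarrow> 'a \<Rightarrow> real) \<Rightarrow> (nat \<Rightarrow> 'a \<Rightarrow> real) \<Rightarrow> nat \<Rightarrow> 'a \<Rightarrow> real" where
  "cumulative_ratio B Y n \<omega> = (\<Sum>k=1..n. Y k \<omega>) / (\<Sum>k=1..n. B k \<omega>)"

end

theory Submission
  imports Defs "HOL-Library.Discrete_Functions"
begin

text \<open>
  With \<open>\<mu> = E[U\<^sub>1]\<close>, the variables \<open>B\<^sub>k (U\<^sub>k - \<mu>)\<close> are pairwise orthogonal with bounded second
  moments, because \<open>U\<^sub>k\<close> is independent of \<open>B\<^sub>k\<close> and of everything up to time \<open>k - 1\<close>. For such a
  sequence the second moment of the partial sum \<open>S\<^sub>n\<close> is \<open>O(n)\<close>; hence \<open>S\<^sub>n / n \<rightarrow> 0\<close> almost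
  everywhere along the squares, and the fluctuation on \<open>{m\<^sup>2..<(m+1)\<^sup>2}\<close> is controlled by summing
  squares over the block, so that no maximal inequality is needed. Dividing by the average bet,
  which stays away from \<open>0\<close>, gives the result.
\<close>

section \<open>Second moments of orthogonal sums\<close>

lemma integrable_mult_if_square_integrable:
  fixes f g :: "'a \<Rightarrow> real"
  assumes [measurable]: "f \<in> borel_measurable M" "g \<in> borel_measurable M"
    and "integrable M (\<lambda>x. (f x)\<^sup>2)" "integrable M (\<lambda>x. (g x)\<^sup>2)"
  shows "integrable M (\<lambda>x. f x * g x)"
proof (rule Bochner_Integration.integrable_bound)
  show "integrable M (\<lambda>x. (f x)\<^sup>2 + (g x)\<^sup>2)"
    using assms by simp
  show "AE x in M. norm (f x * g x) \<le> norm ((f x)\<^sup>2 + (g x)\<^sup>2)"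
  proof (rule AE_I2)
    fix x
    have "2 * (\<bar>f x\<bar> * \<bar>g x\<bar>) \<le> (f x)\<^sup>2 + (g x)\<^sup>2"
      using sum_squares_bound[of "\<bar>f x\<bar>" "\<bar>g x\<bar>"] by (simp add: mult.assoc)
    moreover have "0 \<le> \<bar>f x\<bar> * \<bar>g x\<bar>"
      by simp
    ultimately have "\<bar>f x\<bar> * \<bar>g x\<bar> \<le> (f x)\<^sup>2 + (g x)\<^sup>2"
      by linarith
    then show "norm (f x * g x) \<le> norm ((f x)\<^sup>2 + (g x)\<^sup>2)"
      by (simp add: abs_mult)
  qed
qed simp

lemma
  fixes f :: "'i \<Rightarrow> 'a \<Rightarrow> real"
  assumes meas: "\<And>i. i \<in> A \<Longrightarrow> f i \<in> borel_measurable M"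
    and sq: "\<And>i. i \<in> A \<Longrightarrow> integrable M (\<lambda>x. (f i x)\<^sup>2)"
  shows integrable_sum_power2: "integrable M (\<lambda>x. (\<Sum>i\<in>A. f i x)\<^sup>2)"
    and integral_sum_power2_orthogonal:
      "\<lbrakk>finite A; \<And>i j. \<lbrakk>i \<in> A; j \<in> A; i \<noteq> j\<rbrakk> \<Longrightarrow> (\<integral>x. f i x * f j x \<partial>M) = 0\<rbrakk> \<Longrightarrow>
        (\<integral>x. (\<Sum>i\<in>A. f i x)\<^sup>2 \<partial>M) = (\<Sum>i\<in>A. \<integral>x. (f i x)\<^sup>2 \<partial>M)"
proof -
  have int: "integrable M (\<lambda>x. f i x * f j x)" if "i \<in> A" "j \<in> A" for i j
    using that by (intro integrable_mult_if_square_integrable meas sq)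
  show "integrable M (\<lambda>x. (\<Sum>i\<in>A. f i x)\<^sup>2)"
    unfolding power2_eq_square sum_product
    by (intro Bochner_Integration.integrable_sum int)
  assume "finite A"
    and orth: "\<And>i j. \<lbrakk>i \<in> A; j \<in> A; i \<noteq> j\<rbrakk> \<Longrightarrow> (\<integral>x. f i x * f j x \<partial>M) = 0"
  have "(\<integral>x. (\<Sum>i\<in>A. f i x)\<^sup>2 \<partial>M) = (\<Sum>i\<in>A. \<Sum>j\<in>A. \<integral>x. f i x * f j x \<partial>M)"
    unfolding power2_eq_square sum_product
    by (simp add: Bochner_Integration.integral_sum Bochner_Integration.integrable_sum int)
  \<comment> \<open>Orthogonality kills the off-diagonal entries; the \<open>if\<close> form lets
    \<open>simp\<close> collapse the inner sum to its diagonal term.\<close>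
  also have "\<dots> = (\<Sum>i\<in>A. \<Sum>j\<in>A. if j = i then \<integral>x. (f i x)\<^sup>2 \<partial>M else 0)"
    by (intro sum.cong refl) (auto simp: orth power2_eq_square)
  also have "\<dots> = (\<Sum>i\<in>A. \<integral>x. (f i x)\<^sup>2 \<partial>M)"
    using \<open>finite A\<close> by simp
  finally show "(\<integral>x. (\<Sum>i\<in>A. f i x)\<^sup>2 \<partial>M) = (\<Sum>i\<in>A. \<integral>x. (f i x)\<^sup>2 \<partial>M)" .
qed

section \<open>Strong law for orthogonal sequences\<close>

lemma AE_tendsto_zero_if_summable_integrals:
  fixes f :: "nat \<Rightarrow> 'a \<Rightarrow> real"
  assumes int: "\<And>n. integrable M (f n)"
    and nonneg: "\<And>n x. 0 \<le> f n x"
    and summable: "summable (\<lambda>n. \<integral>x. f n x \<partial>M)"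
  shows "AE x in M. (\<lambda>n. f n x) \<longlonglongrightarrow> 0"
proof -
  have [measurable]: "f n \<in> borel_measurable M" for n
    using int by simp
  \<comment> \<open>Monotone convergence: the series has a finite integral, so it is finite almost
    everywhere, and at such points its terms tend to 0.\<close>
  have "(\<integral>\<^sup>+x. (\<Sum>n. ennreal (f n x)) \<partial>M) = (\<Sum>n. ennreal (\<integral>x. f n x \<partial>M))"
    by (simp add: nn_integral_suminf nn_integral_eq_integral int nonneg)
  also have "\<dots> \<noteq> \<infinity>"
    using summable nonneg by (simp add: suminf_ennreal2)
  finally have "AE x in M. (\<Sum>n. ennreal (f n x)) \<noteq> \<infinity>"
    by (intro nn_integral_noteq_infinite) auto
  then show ?thesis
  proof (rule AE_mp, intro AE_I2 impI)
    fix x assume "(\<Sum>n. ennreal (f n x)) \<noteq> \<infinity>"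
    then have "summable (\<lambda>n. f n x)"
      by (intro summable_suminf_not_top nonneg) simp
    then show "(\<lambda>n. f n x) \<longlonglongrightarrow> 0"
      by (rule summable_LIMSEQ_zero)
  qed
qed

lemma filterlim_floor_sqrt: "filterlim floor_sqrt at_top at_top"
  unfolding filterlim_at_top eventually_at_top_linorder
  using le_floor_sqrtI by blast

theorem strong_law_orthogonal:
  fixes f :: "nat \<Rightarrow> 'a \<Rightarrow> real"
  assumes meas [measurable]: "\<And>k. f k \<in> borel_measurable M"
    and sq: "\<And>k. integrable M (\<lambda>x. (f k x)\<^sup>2)"
    and bound: "\<And>k. (\<integral>x. (f k x)\<^sup>2 \<partial>M) \<le> C"
    and orth: "\<And>j k. j < k \<Longrightarrow> (\<integral>x. f j x * f k x \<partial>M) = 0"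
  shows "AE x in M. (\<lambda>n. (\<Sum>k<n. f k x) / real n) \<longlonglongrightarrow> 0"
proof -
  define S where "S n x = (\<Sum>k<n. f k x)" for n x
  \<comment> \<open>\<open>W m\<close> controls a whole block at once: up to a factor 2 it dominates
    \<open>(S n x)\<^sup>2\<close> for every \<open>n\<close> from \<open>m\<^sup>2\<close> up to
    the next square. Summing over the block takes the place of a maximum over it.\<close>
  define W where "W m x = (S (m\<^sup>2) x)\<^sup>2 + (\<Sum>n\<in>{m\<^sup>2..<(Suc m)\<^sup>2}. (\<Sum>k\<in>{m\<^sup>2..<n}. f k x)\<^sup>2)" for m x
  have C: "0 \<le> C"
    using bound[of 0] by (smt (verit) integral_nonneg_AE AE_I2 zero_le_power2)
  have orth': "(\<integral>x. f j x * f k x \<partial>M) = 0" if "j \<noteq> k" for j k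
    using that orth[of j k] orth[of k j] by (cases j k rule: linorder_cases) (auto simp: mult.commute)
  have int_sum: "integrable M (\<lambda>x. (\<Sum>k\<in>A. f k x)\<^sup>2)" for A
    by (intro integrable_sum_power2 meas sq)
  have sum_le: "(\<integral>x. (\<Sum>k\<in>A. f k x)\<^sup>2 \<partial>M) \<le> C * card A" if "finite A" for A
  proof -
    have "(\<integral>x. (\<Sum>k\<in>A. f k x)\<^sup>2 \<partial>M) = (\<Sum>k\<in>A. \<integral>x. (f k x)\<^sup>2 \<partial>M)"
      using that by (intro integral_sum_power2_orthogonal meas sq orth')
    also have "\<dots> \<le> card A * C"
      by (intro sum_bounded_above bound)
    finally show ?thesis
      by (simp add: mult.commute)
  qed
  have int_W: "integrable M (W m)" for m
    unfolding W_def S_def by (intro Bochner_Integration.integrable_add Bochner_Integration.integrable_sum int_sum)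
  have W_nonneg: "0 \<le> W m x" for m x
    unfolding W_def by (intro add_nonneg_nonneg sum_nonneg) auto
  \<comment> \<open>The initial sum has \<open>m\<^sup>2\<close> terms; the block contributes 2m+1
    partial sums of at most 2m+1 terms each. So the integral is at most C (m^2 + (2m+1)^2) = C (5m^2
    + 4m + 1), and m and 1 are at most m^2 for m at least 1.\<close>
  have W_le: "(\<integral>x. W m x \<partial>M) \<le> C * (10 * real m ^ 2)" if "m \<ge> 1" for m
  proof -
    have *: "card {m\<^sup>2..<(Suc m)\<^sup>2} = 2 * m + 1"
      by (simp add: power2_eq_square)
    have "(\<integral>x. W m x \<partial>M) = (\<integral>x. (\<Sum>k<m\<^sup>2. f k x)\<^sup>2 \<partial>M) +
        (\<Sum>n\<in>{m\<^sup>2..<(Suc m)\<^sup>2}. \<integral>x. (\<Sum>k\<in>{m\<^sup>2..<n}. f k x)\<^sup>2 \<partial>M)"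
      unfolding W_def S_def
      by (simp add: Bochner_Integration.integral_add Bochner_Integration.integral_sum
          Bochner_Integration.integrable_sum int_sum)
    also have "\<dots> \<le> C * card {..<m\<^sup>2} + (\<Sum>n\<in>{m\<^sup>2..<(Suc m)\<^sup>2}. C * (2 * m + 1))"
    proof (intro add_mono sum_mono sum_le)
      fix n assume n: "n \<in> {m\<^sup>2..<(Suc m)\<^sup>2}"
      have "(\<integral>x. (\<Sum>k\<in>{m\<^sup>2..<n}. f k x)\<^sup>2 \<partial>M) \<le> C * card {m\<^sup>2..<n}"
        by (rule sum_le) simp
      also have "card {m\<^sup>2..<n} \<le> 2 * m + 1"
        using n by (auto simp: power2_eq_square)
      then have "C * card {m\<^sup>2..<n} \<le> C * (2 * m + 1)"
        using C by (intro mult_left_mono of_nat_mono) auto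
      finally show "(\<integral>x. (\<Sum>k\<in>{m\<^sup>2..<n}. f k x)\<^sup>2 \<partial>M) \<le> C * (2 * m + 1)" .
    qed simp
    also have "\<dots> = C * (5 * real m ^ 2 + 4 * real m + 1)"
      by (simp only: sum_constant * card_lessThan) (simp add: algebra_simps power2_eq_square)
    also have "\<dots> \<le> C * (10 * real m ^ 2)"
    proof (rule mult_left_mono[OF _ C])
      have "real m \<le> real m ^ 2" "1 \<le> real m ^ 2"
        using that by (intro self_le_power one_le_power; simp)+
      then show "5 * real m ^ 2 + 4 * real m + 1 \<le> 10 * real m ^ 2"
        by linarith
    qed
    finally show ?thesis .
  qed
  \<comment> \<open>Since \<open>n\<close> is of order \<open>m\<^sup>2\<close> on the block,
    dividing by m^4 corresponds to squaring \<open>S n x / real n\<close>. The integrals are then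
    O(1/m^2), hence summable; the crude sum over the block is affordable because blocks between
    squares have length of order m only.\<close>
  have "AE x in M. (\<lambda>m. W m x / real m ^ 4) \<longlonglongrightarrow> 0"
  proof (rule AE_tendsto_zero_if_summable_integrals)
    show "integrable M (\<lambda>x. W m x / real m ^ 4)" for m
      by (simp add: int_W)
    show "0 \<le> W m x / real m ^ 4" for m x
      by (simp add: W_nonneg)
    have "summable (\<lambda>m. 10 * C * inverse (real m ^ 2))"
      by (intro summable_mult inverse_power_summable) simp
    then show "summable (\<lambda>m. \<integral>x. W m x / real m ^ 4 \<partial>M)"
    proof (rule summable_comparison_test')
      fix m :: nat assume m: "1 \<le> m"
      have "norm (\<integral>x. W m x / real m ^ 4 \<partial>M) = (\<integral>x. W m x \<partial>M) / real m ^ 4"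
        by (simp add: W_nonneg integral_nonneg_AE)
      also have "\<dots> \<le> C * (10 * real m ^ 2) / real m ^ 4"
        by (intro divide_right_mono W_le m) simp
      also have "\<dots> = 10 * C * inverse (real m ^ 2)"
        using m by (simp add: field_simps eval_nat_numeral)
      finally show "norm (\<integral>x. W m x / real m ^ 4 \<partial>M) \<le> 10 * C * inverse (real m ^ 2)" .
    qed
  qed
  then show ?thesis
  proof (rule AE_mp, intro AE_I2 impI)
    fix x assume "(\<lambda>m. W m x / real m ^ 4) \<longlonglongrightarrow> 0"
    \<comment> \<open>The block containing \<open>n\<close> is the one with index
      \<open>floor_sqrt n\<close>, which tends to infinity with \<open>n\<close>.\<close>
    then have "(\<lambda>n. W (floor_sqrt n) x / real (floor_sqrt n) ^ 4) \<longlonglongrightarrow> 0"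
      by (rule filterlim_compose[OF _ filterlim_floor_sqrt])
    then have lim: "(\<lambda>n. 2 * (W (floor_sqrt n) x / real (floor_sqrt n) ^ 4)) \<longlonglongrightarrow> 0"
      by (rule tendsto_mult_right_zero)
    have "(\<lambda>n. (S n x / real n)\<^sup>2) \<longlonglongrightarrow> 0"
    proof (rule tendsto_sandwich[OF _ _ tendsto_const lim])
      show "\<forall>\<^sub>F n in sequentially. (S n x / real n)\<^sup>2 \<le> 2 * (W (floor_sqrt n) x / real (floor_sqrt n) ^ 4)"
        using eventually_ge_at_top[of 1]
      proof eventually_elim
        fix n :: nat assume n: "1 \<le> n"
        define m where "m = floor_sqrt n"
        have m: "m\<^sup>2 \<le> n" "n < (Suc m)\<^sup>2" "0 < m"
          using n by (auto simp only: m_def floor_sqrt_power2_le Suc_floor_sqrt_power2_gt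
              floor_sqrt_greater_zero_iff)
        define T where "T = (\<Sum>k\<in>{m\<^sup>2..<n}. f k x)"
        have "{..<n} = {..<m\<^sup>2} \<union> {m\<^sup>2..<n}"
          using m by auto
        then have S: "S n x = S (m\<^sup>2) x + T"
          unfolding S_def T_def by (simp add: sum.union_disjoint ivl_disj_int)
        \<comment> \<open>The square for this particular \<open>n\<close> is one of the nonnegative
          summands in \<open>W m\<close>.\<close>
        have T: "T\<^sup>2 \<le> (\<Sum>n\<in>{m\<^sup>2..<(Suc m)\<^sup>2}. (\<Sum>k\<in>{m\<^sup>2..<n}. f k x)\<^sup>2)"
          unfolding T_def using m by (intro member_le_sum) auto
        have "(S n x)\<^sup>2 \<le> 2 * (S (m\<^sup>2) x)\<^sup>2 + 2 * T\<^sup>2"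
          unfolding S using sum_squares_bound[of "S (m\<^sup>2) x" T] by (simp add: power2_sum)
        also have "\<dots> \<le> 2 * W m x"
          using T by (simp add: W_def)
        finally have "(S n x)\<^sup>2 \<le> 2 * W m x" .
        moreover have "real m ^ 4 \<le> real n ^ 2"
        proof -
          have "(m\<^sup>2)\<^sup>2 \<le> n\<^sup>2"
            using m(1) by (rule power_mono) simp
          then have "m ^ 4 \<le> n ^ 2"
            by (simp flip: power_mult)
          then have "real (m ^ 4) \<le> real (n ^ 2)"
            by (rule of_nat_mono)
          then show ?thesis by simp
        qed
        ultimately have "(S n x)\<^sup>2 / real n ^ 2 \<le> 2 * W m x / real m ^ 4"
          using m(3) W_nonneg[of m x] by (intro frac_le) auto
        then show "(S n x / real n)\<^sup>2 \<le> 2 * (W (floor_sqrt n) x / real (floor_sqrt n) ^ 4)"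
          by (simp add: power_divide m_def)
      qed
    qed simp
    then have "(\<lambda>n. S n x / real n) \<longlonglongrightarrow> 0"
      using tendsto_real_sqrt[of "\<lambda>n. (S n x / real n)\<^sup>2" 0 sequentially]
      by (simp only: real_sqrt_abs real_sqrt_zero tendsto_rabs_zero_iff)
    then show "(\<lambda>n. (\<Sum>k<n. f k x) / real n) \<longlonglongrightarrow> 0"
      by (simp add: S_def)
  qed
qed

section \<open>Predictable bets: independence, and the passage to ratios\<close>

lemma (in prob_space) indep_var_if_indep_of_algebra:
  assumes "subalgebra M G" "indep_of_algebra M Y G" "Z \<in> borel_measurable G"
  shows "indep_var borel Y borel Z"
proof -
  have sp: "space G = space M"
    using assms(1) by (simp add: subalgebra_def)
  \<comment> \<open>The sigma-algebra generated by \<open>Z\<close> lies inside \<open>G\<close>, so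
    independence of \<open>G\<close> passes down to it.\<close>
  have "sigma_sets (space M) {Z -` A \<inter> space M |A. A \<in> sets borel} \<subseteq> sets G"
    unfolding sp[symmetric] using assms(3)
    by (intro sets.sigma_sets_subset) (auto intro: measurable_sets)
  moreover have "indep_set (sigma_sets (space M) {Y -` A \<inter> space M |A. A \<in> sets borel}) (sets G)"
    using assms(2) by (simp add: indep_of_algebra_def sets_vimage_algebra)
  ultimately have "indep_set (sigma_sets (space M) {Y -` A \<inter> space M |A. A \<in> sets borel})
      (sigma_sets (space M) {Z -` A \<inter> space M |A. A \<in> sets borel})"
    unfolding indep_sets2_eq by blast
  then show ?thesis
    using assms measurable_from_subalg[OF assms(1,3)]
    by (simp add: indep_var_eq indep_of_algebra_def)
qed

text \<open>This is applied path by path. The ratio minus \<open>c\<close> is the centred average in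
  \<open>lim\<close> times the inverse of the average of \<open>b\<close>; the former tends to 0,
  and the latter is bounded because the averages eventually stay above a positive constant.\<close>

lemma ratio_tendsto:
  fixes b y :: "nat \<Rightarrow> real"
  assumes lim: "(\<lambda>n. (\<Sum>k=1..n. y k - c * b k) / real n) \<longlonglongrightarrow> 0"
    and pos: "liminf (\<lambda>n. ereal (1 / real n * (\<Sum>k=1..n. b k))) > 0"
  shows "(\<lambda>n. (\<Sum>k=1..n. y k) / (\<Sum>k=1..n. b k)) \<longlonglongrightarrow> c"
proof -
  \<comment> \<open>The liminf is an extended real and may be infinite, so a real threshold strictly
    between 0 and it is chosen.\<close>
  obtain \<delta> where \<delta>: "0 < \<delta>" "ereal \<delta> < liminf (\<lambda>n. ereal (1 / real n * (\<Sum>k=1..n. b k)))"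
    using ereal_dense2[OF pos] by auto
  have ev: "\<forall>\<^sub>F n in sequentially. \<delta> < (\<Sum>k=1..n. b k) / real n"
    using less_LiminfD[OF \<delta>(2)] by simp
  have bfun: "Bfun (\<lambda>n. inverse ((\<Sum>k=1..n. b k) / real n)) sequentially"
  proof (rule BfunI)
    show "\<forall>\<^sub>F n in sequentially. norm (inverse ((\<Sum>k=1..n. b k) / real n)) \<le> inverse \<delta>"
      using ev
    proof eventually_elim
      fix n assume "\<delta> < (\<Sum>k=1..n. b k) / real n"
      then have "inverse ((\<Sum>k=1..n. b k) / real n) \<le> inverse \<delta>" "0 < (\<Sum>k=1..n. b k) / real n"
        using \<delta>(1) by (rule le_imp_inverse_le[OF less_imp_le], rule less_trans[rotated])
      then show "norm (inverse ((\<Sum>k=1..n. b k) / real n)) \<le> inverse \<delta>"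
        by (simp only: real_norm_def abs_of_pos positive_imp_inverse_positive)
    qed
  qed
  have "Zfun (\<lambda>n. (\<Sum>k=1..n. y k - c * b k) / real n * inverse ((\<Sum>k=1..n. b k) / real n)) sequentially"
    using lim bfun by (intro bounded_bilinear.Zfun_prod_Bfun[OF bounded_bilinear_mult])
      (simp add: tendsto_Zfun_iff)
  then have "(\<lambda>n. c + (\<Sum>k=1..n. y k - c * b k) / real n * inverse ((\<Sum>k=1..n. b k) / real n)) \<longlonglongrightarrow> c"
    by (simp add: tendsto_Zfun_iff)
  then show ?thesis
  proof (rule Lim_transform_eventually)
    show "\<forall>\<^sub>F n in sequentially. c + (\<Sum>k=1..n. y k - c * b k) / real n * inverse ((\<Sum>k=1..n. b k) / real n)
        = (\<Sum>k=1..n. y k) / (\<Sum>k=1..n. b k)"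
      using ev eventually_gt_at_top[of 0]
    proof eventually_elim
      fix n :: nat assume "\<delta> < (\<Sum>k=1..n. b k) / real n" "0 < n"
      then have "(\<Sum>k=1..n. b k) \<noteq> 0"
        using \<delta>(1) by auto
      then show "c + (\<Sum>k=1..n. y k - c * b k) / real n * inverse ((\<Sum>k=1..n. b k) / real n)
          = (\<Sum>k=1..n. y k) / (\<Sum>k=1..n. b k)"
        using \<open>0 < n\<close> by (simp add: sum_subtractf field_simps flip: sum_distrib_left)
    qed
  qed
qed

text \<open>Returns and profits are both instances of \<open>U\<close>, which carries no sign
  condition because profits may be negative.\<close>

theorem (in prob_space) predictable_ratio_tendsto:
  fixes B U :: "nat \<Rightarrow> 'a \<Rightarrow> real"
  assumes filt: "filtration_on M F"
    and pred: "predictable_seq F B"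
    and ident: "\<And>n. n \<ge> 1 \<Longrightarrow> distr M borel (U n) = distr M borel (U 1)"
    and adapt: "adapted_seq F U"
    and indep: "\<And>n. n \<ge> 1 \<Longrightarrow> indep_of_algebra M (U n) (F (n - 1))"
    and Bsq: "(SUP n\<in>{1..}. \<integral>\<^sup>+\<omega>. ennreal ((B n \<omega>)\<^sup>2) \<partial>M) < \<infinity>"
    and Usq: "integrable M (\<lambda>\<omega>. (U 1 \<omega>)\<^sup>2)"
    and pos: "AE \<omega> in M. liminf (\<lambda>n. ereal (1 / real n * (\<Sum>k=1..n. B k \<omega>))) > 0"
    and Y: "\<And>n \<omega>. n \<ge> 1 \<Longrightarrow> \<omega> \<in> space M \<Longrightarrow> Y n \<omega> = B n \<omega> * U n \<omega>"
  shows "AE \<omega> in M. (\<lambda>n. cumulative_ratio B Y n \<omega>) \<longlonglongrightarrow> expectation (U 1)"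
proof -
  define \<mu> where "\<mu> = expectation (U 1)"
  \<comment> \<open>The strong law indexes from 0, so \<open>D k\<close> and \<open>f k\<close>
    belong to coup k+1. Thus \<open>F k\<close> is the information before that coup:
    \<open>B (Suc k)\<close> is measurable with respect to it and \<open>D k\<close> is independent
    of it.\<close>
  define D where "D k \<omega> = U (Suc k) \<omega> - \<mu>" for k \<omega>
  define f where "f k \<omega> = D k \<omega> * B (Suc k) \<omega>" for k \<omega>
  have sub: "subalgebra M (F n)" for n
    using filt by (simp add: filtration_on_def)
  have mono: "subalgebra (F n) (F m)" if "m \<le> n" for m n
    using filt that filtration.sets_F_mono[of "space M" F m n] filtration.space_F[of "space M" F]
    by (auto simp: filtration_on_def subalgebra_def)
  have B_F: "B (Suc k) \<in> borel_measurable (F k)" for k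
    using pred by (auto simp: predictable_seq_def dest: spec[of _ "Suc k"])
  have U_F: "U (Suc k) \<in> borel_measurable (F (Suc k))" for k
    using adapt by (auto simp: adapted_seq_def)
  have f_F: "f j \<in> borel_measurable (F k)" if "j < k" for j k
  proof -
    have [measurable]: "B (Suc j) \<in> borel_measurable (F k)" "U (Suc j) \<in> borel_measurable (F k)"
      using that by (auto intro: measurable_from_subalg[OF mono B_F] measurable_from_subalg[OF mono U_F])
    then show ?thesis
      unfolding f_def D_def by measurable
  qed
  have B_M [measurable]: "B (Suc k) \<in> borel_measurable M" and U_M [measurable]: "U (Suc k) \<in> borel_measurable M" for k
    by (rule measurable_from_subalg[OF sub B_F], rule measurable_from_subalg[OF sub U_F])
  have U1_M: "U 1 \<in> borel_measurable M"
    using U_M[of 0] by simp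
  \<comment> \<open>Used with \<open>Z\<close> the bet itself for second moments, and with
    \<open>Z\<close> an earlier term times the bet for orthogonality.\<close>
  have indep_D: "indep_var borel (D k) borel Z" if "Z \<in> borel_measurable (F k)" for k Z
  proof -
    have "indep_var borel (U (Suc k)) borel Z"
      using indep[of "Suc k"] that by (intro indep_var_if_indep_of_algebra[OF sub]) auto
    then have "indep_var borel ((\<lambda>u. u - \<mu>) \<circ> U (Suc k)) borel (id \<circ> Z)"
      by (rule indep_var_compose) auto
    then show ?thesis
      by (simp add: comp_def D_def[abs_def])
  qed
  \<comment> \<open>Both sides are statements about \<open>h\<close> under the common distribution
    of the \<open>U n\<close>.\<close>
  have transfer: "integrable M (\<lambda>\<omega>. h (U (Suc k) \<omega>)) \<longleftrightarrow> integrable M (\<lambda>\<omega>. h (U 1 \<omega>))"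
    "expectation (\<lambda>\<omega>. h (U (Suc k) \<omega>)) = expectation (\<lambda>\<omega>. h (U 1 \<omega>))"
    if [measurable]: "h \<in> borel_measurable borel" for h :: "real \<Rightarrow> real" and k
    using integrable_distr_eq[OF U_M[of k] that] integrable_distr_eq[OF U1_M that]
      integral_distr[OF U_M[of k] that] integral_distr[OF U1_M that] ident[of "Suc k"]
    by auto
  have U1: "integrable M (U 1)"
    using U1_M Usq by (rule square_integrable_imp_integrable)
  have D_int: "integrable M (D k)" for k
    unfolding D_def using transfer(1)[of "\<lambda>u. u - \<mu>" k] U1 by simp
  have D_mean: "expectation (D k) = 0" for k
    unfolding D_def using transfer(2)[of "\<lambda>u. u - \<mu>" k] U1 by (simp add: \<mu>_def prob_space)
  define V where "V = expectation (\<lambda>\<omega>. (U 1 \<omega> - \<mu>)\<^sup>2)"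
  have Dsq_int: "integrable M (\<lambda>\<omega>. (D k \<omega>)\<^sup>2)" for k
  proof -
    have "integrable M (\<lambda>\<omega>. (U 1 \<omega> - \<mu>)\<^sup>2)"
      unfolding power2_diff using U1 Usq by simp
    then show ?thesis
      unfolding D_def using transfer(1)[of "\<lambda>u. (u - \<mu>)\<^sup>2" k] by simp
  qed
  have Dsq: "expectation (\<lambda>\<omega>. (D k \<omega>)\<^sup>2) = V" for k
    unfolding D_def V_def using transfer(2)[of "\<lambda>u. (u - \<mu>)\<^sup>2" k] by simp
  have V: "0 \<le> V"
    by (simp add: V_def)
  obtain K where K: "0 \<le> K" "(SUP n\<in>{1..}. \<integral>\<^sup>+\<omega>. ennreal ((B n \<omega>)\<^sup>2) \<partial>M) = ennreal K"
    using Bsq unfolding infinity_ennreal_def less_top_ennreal by blast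
  have B_nn: "(\<integral>\<^sup>+\<omega>. ennreal ((B (Suc k) \<omega>)\<^sup>2) \<partial>M) \<le> ennreal K" for k
    unfolding K(2)[symmetric] by (rule SUP_upper) simp
  have Bsq_int: "integrable M (\<lambda>\<omega>. (B (Suc k) \<omega>)\<^sup>2)" for k
    by (rule integrableI_bounded) (use B_nn[of k] in \<open>auto intro: le_less_trans\<close>)
  have Bsq_le: "expectation (\<lambda>\<omega>. (B (Suc k) \<omega>)\<^sup>2) \<le> K" for k
    using B_nn[of k] Bsq_int[of k] K(1) by (simp add: nn_integral_eq_integral)
  have indep_sq: "indep_var borel (\<lambda>\<omega>. (D k \<omega>)\<^sup>2) borel (\<lambda>\<omega>. (B (Suc k) \<omega>)\<^sup>2)" for k
    using indep_var_compose[OF indep_D[OF B_F], of "\<lambda>u. u\<^sup>2" borel "\<lambda>u. u\<^sup>2" borel k]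
    by (simp add: comp_def)
  have f_M [measurable]: "f k \<in> borel_measurable M" for k
    unfolding f_def D_def by measurable
  \<comment> \<open>A product of independent integrable variables is integrable, so no fourth
    moments enter.\<close>
  have fsq_int: "integrable M (\<lambda>\<omega>. (f k \<omega>)\<^sup>2)" for k
    unfolding f_def power_mult_distrib by (intro indep_var_integrable indep_sq Dsq_int Bsq_int)
  have "AE \<omega> in M. (\<lambda>n. (\<Sum>k<n. f k \<omega>) / real n) \<longlonglongrightarrow> 0"
  proof (rule strong_law_orthogonal[OF f_M fsq_int])
    fix k
    have "expectation (\<lambda>\<omega>. (f k \<omega>)\<^sup>2) = V * expectation (\<lambda>\<omega>. (B (Suc k) \<omega>)\<^sup>2)"
      unfolding f_def power_mult_distrib
      by (simp add: indep_var_lebesgue_integral[OF indep_sq Dsq_int Bsq_int] Dsq)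
    also have "\<dots> \<le> V * K"
      by (intro mult_left_mono Bsq_le V)
    finally show "expectation (\<lambda>\<omega>. (f k \<omega>)\<^sup>2) \<le> V * K" .
  next
    fix j k :: nat assume "j < k"
    \<comment> \<open>Everything in \<open>f j * f k\<close> except \<open>D k\<close> is known at
      time \<open>k\<close>. Grouping it into \<open>Z\<close> makes the expectation factor as
      E[D k] E[Z] = 0, without conditional expectations.\<close>
    define Z where "Z \<omega> = f j \<omega> * B (Suc k) \<omega>" for \<omega>
    have Z_F: "Z \<in> borel_measurable (F k)"
      unfolding Z_def using f_F[OF \<open>j < k\<close>] B_F[of k] by measurable
    have Z_int: "integrable M Z"
      unfolding Z_def by (intro integrable_mult_if_square_integrable f_M B_M fsq_int Bsq_int)
    have "expectation (\<lambda>\<omega>. f j \<omega> * f k \<omega>) = expectation (\<lambda>\<omega>. D k \<omega> * Z \<omega>)"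
      by (simp add: Z_def f_def mult_ac)
    also have "\<dots> = 0"
      by (simp add: indep_var_lebesgue_integral[OF indep_D[OF Z_F] D_int Z_int] D_mean)
    finally show "expectation (\<lambda>\<omega>. f j \<omega> * f k \<omega>) = 0" .
  qed
  \<comment> \<open>\<open>AE_space\<close> supplies membership in \<open>space M\<close>, where the
    product formula \<open>Y\<close> is assumed.\<close>
  with pos AE_space show ?thesis
  proof eventually_elim
    fix \<omega>
    assume pos: "0 < liminf (\<lambda>n. ereal (1 / real n * (\<Sum>k=1..n. B k \<omega>)))"
      and "\<omega> \<in> space M" and lim: "(\<lambda>n. (\<Sum>k<n. f k \<omega>) / real n) \<longlonglongrightarrow> 0"
    have "(\<Sum>k<n. f k \<omega>) = (\<Sum>k=1..n. Y k \<omega> - \<mu> * B k \<omega>)" for n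
      using \<open>\<omega> \<in> space M\<close>
      by (simp add: sum.atLeast1_atMost_eq f_def D_def Y algebra_simps)
    with lim have "(\<lambda>n. (\<Sum>k=1..n. Y k \<omega> - \<mu> * B k \<omega>) / real n) \<longlonglongrightarrow> 0"
      by simp
    from ratio_tendsto[OF this pos]
    show "(\<lambda>n. cumulative_ratio B Y n \<omega>) \<longlonglongrightarrow> expectation (U 1)"
      by (simp add: cumulative_ratio_def \<mu>_def)
  qed
qed

section \<open>Second moments of returns and profits, and the conclusion\<close>

lemma nn_integral_power2_finite_iff:
  fixes f :: "'a \<Rightarrow> real"
  assumes "f \<in> borel_measurable M"
  shows "(\<integral>\<^sup>+x. ennreal ((f x)\<^sup>2) \<partial>M) < \<infinity> \<longleftrightarrow> integrable M (\<lambda>x. (f x)\<^sup>2)"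
  using assms by (simp add: integrable_iff_bounded)

text \<open>On a probability space square integrability gives integrability, which handles the cross
  term, and constants are integrable. With shifts -1 and 1 this yields the equivalence of the two
  moment conditions.\<close>

lemma (in prob_space) square_integrable_add_const:
  fixes f g :: "'a \<Rightarrow> real"
  assumes f: "f \<in> borel_measurable M" "integrable M (\<lambda>x. (f x)\<^sup>2)"
    and g: "\<And>x. x \<in> space M \<Longrightarrow> g x = f x + c"
  shows "integrable M (\<lambda>x. (g x)\<^sup>2)"
proof -
  have "integrable M (\<lambda>x. (f x + c)\<^sup>2)"
    unfolding power2_sum using f square_integrable_imp_integrable[OF f] by simp
  then show ?thesis
    using g by (simp cong: Bochner_Integration.integrable_cong)
qed

theorem corollary4p1:
  fixes M :: "'a measure"
    and F :: "nat \<Rightarrow> 'a measure"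
    and B Ro Xo R X :: "nat \<Rightarrow> 'a \<Rightarrow> real"
  assumes "prob_space M"
    and "filtration_on M F"
    and "\<And>n \<omega>. n \<ge> 1 \<Longrightarrow> \<omega> \<in> space M \<Longrightarrow> B n \<omega> \<ge> 0"
    and "predictable_seq F B"
    and "\<And>n \<omega>. n \<ge> 1 \<Longrightarrow> \<omega> \<in> space M \<Longrightarrow> Ro n \<omega> \<ge> 0"
    and "\<And>n \<omega>. n \<ge> 1 \<Longrightarrow> \<omega> \<in> space M \<Longrightarrow> Xo n \<omega> = Ro n \<omega> - 1"
    and "iid_seq M Ro" and "iid_seq M Xo"
    and "adapted_seq F Ro" and "adapted_seq F Xo"
    and "\<And>n. n \<ge> 1 \<Longrightarrow> indep_of_algebra M (Ro n) (F (n - 1))"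
    and "\<And>n. n \<ge> 1 \<Longrightarrow> indep_of_algebra M (Xo n) (F (n - 1))"
    and "\<And>n \<omega>. n \<ge> 1 \<Longrightarrow> \<omega> \<in> space M \<Longrightarrow> R n \<omega> = B n \<omega> * Ro n \<omega>"
    and "\<And>n \<omega>. n \<ge> 1 \<Longrightarrow> \<omega> \<in> space M \<Longrightarrow> X n \<omega> = B n \<omega> * Xo n \<omega>"
    and "(SUP n\<in>{1..}. \<integral>\<^sup>+\<omega>. ennreal ((B n \<omega>)\<^sup>2) \<partial>M) < \<infinity>"
    and "AE \<omega> in M. liminf (\<lambda>n. ereal (1 / real n * (\<Sum>k=1..n. B k \<omega>))) > 0"
  shows "((\<integral>\<^sup>+\<omega>. ennreal ((Ro 1 \<omega>)\<^sup>2) \<partial>M) < \<infinity> \<longleftrightarrow>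
          (\<integral>\<^sup>+\<omega>. ennreal ((Xo 1 \<omega>)\<^sup>2) \<partial>M) < \<infinity>) \<and>
         ((\<integral>\<^sup>+\<omega>. ennreal ((Ro 1 \<omega>)\<^sup>2) \<partial>M) < \<infinity> \<longrightarrow>
          (AE \<omega> in M. (\<lambda>n. cumulative_ratio B R n \<omega>) \<longlonglongrightarrow> RTP M (\<lambda>_. 1) (Ro 1)) \<and>
          (AE \<omega> in M. (\<lambda>n. cumulative_ratio B X n \<omega>) \<longlonglongrightarrow> - HA M (\<lambda>_. 1) (Xo 1)))"
proof -
  interpret prob_space M by (rule assms(1))
  have meas: "Ro 1 \<in> borel_measurable M" "Xo 1 \<in> borel_measurable M"
    using assms(11,12)[of 1] by (auto simp: indep_of_algebra_def)
  have fin: "(\<integral>\<^sup>+\<omega>. ennreal ((Ro 1 \<omega>)\<^sup>2) \<partial>M) < \<infinity> \<longleftrightarrow> integrable M (\<lambda>\<omega>. (Ro 1 \<omega>)\<^sup>2)"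
    "(\<integral>\<^sup>+\<omega>. ennreal ((Xo 1 \<omega>)\<^sup>2) \<partial>M) < \<infinity> \<longleftrightarrow> integrable M (\<lambda>\<omega>. (Xo 1 \<omega>)\<^sup>2)"
    by (intro nn_integral_power2_finite_iff meas)+
  have iff: "integrable M (\<lambda>\<omega>. (Ro 1 \<omega>)\<^sup>2) \<longleftrightarrow> integrable M (\<lambda>\<omega>. (Xo 1 \<omega>)\<^sup>2)"
    using square_integrable_add_const[OF meas(1), of "Xo 1" "- 1"]
      square_integrable_add_const[OF meas(2), of "Ro 1" 1] assms(6)[of 1] by auto
  have ident: "distr M borel (Ro n) = distr M borel (Ro 1)" "distr M borel (Xo n) = distr M borel (Xo 1)"
    if "n \<ge> 1" for n
    using assms(7,8) that unfolding iid_seq_def by blast+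
  have "AE \<omega> in M. (\<lambda>n. cumulative_ratio B R n \<omega>) \<longlonglongrightarrow> expectation (Ro 1)"
    if "integrable M (\<lambda>\<omega>. (Ro 1 \<omega>)\<^sup>2)"
    by (rule predictable_ratio_tendsto[where F = F and B = B and U = Ro and Y = R,
          OF assms(2,4) ident(1) assms(9,11,15) that assms(16,13)])
  moreover have "AE \<omega> in M. (\<lambda>n. cumulative_ratio B X n \<omega>) \<longlonglongrightarrow> expectation (Xo 1)"
    if "integrable M (\<lambda>\<omega>. (Xo 1 \<omega>)\<^sup>2)"
    by (rule predictable_ratio_tendsto[where F = F and B = B and U = Xo and Y = X,
          OF assms(2,4) ident(2) assms(10,12,15) that assms(16,14)])
  ultimately show ?thesis
    \<comment> \<open>For the unit bet the denominator is the total mass 1, and the two minus signs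
      around \<open>HA\<close> cancel.\<close>
    unfolding fin using iff by (simp add: RTP_def HA_def prob_space)
qed

end
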